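(* Let $G=(V,E)$ be a simple undirected unweighted graph with vertex set $V=\{1,\dots,n\}$. Then $$\frac12\le h_{\max}(G)\le h^+(G)\le \widehat{h}^+(G)\le \frac{\lambda_n-h^+(G)}{1+\lambda_n-2h^+(G)} \le \frac{\lambda_n-\widehat{h}^+(G)}{1+\lambda_n-2\widehat{h}^+(G)} \le \frac{\lambda_n}{2}\le 1,$$ where $\lambda_n$ is the largest eigenvalue of the eigenproblem $\Delta_2\vec x=\lambda D\vec x$ of the graph Laplacian $\Delta_2$ of $G$.
   Context: $d_i$ is the degree of vertex $i$, $D=\mathrm{diag}(d_1,\dots,d_n)$, $\mathrm{vol}(S)=\sum_{i\in S}d_i$ for $S\subset V$, $S^c=V\setminus S$, and for disjoint $V_1,V_2\subset V$, $E(V_1,V_2)$ is the set of edges with one endpoint in $V_1$ and the other in $V_2$. Maxcut: $h_{\max}(G)=\max_{V_1\subset V}\dfrac{2|E(V_1,V_1^c)|}{\mathrm{vol}(V)}$. Dual Cheeger constant: $h^+(G)=\max\limits_{V_1\cap V_2=\emptyset,\,V_1\cup V_2\neq\emptyset}\dfrac{2|E(V_1,V_2)|}{\mathrm{vol}(V_1\cup V_2)}$. Modified dual Cheeger constant: $\widehat h^+(G)=\max\limits_{V_1\cap V_2=\emptyset,\,V_1\cup V_2\neq\emptyset}\dfrac{2|E(V_1,V_2)|+|E(V_1\cup V_2,(V_1\cup V_2)^c)|}{\mathrm{vol}(V_1\cup V_2)+|E(V_1\cup V_2,(V_1\cup V_2)^c)|}$. In the last two, $V_1,V_2$ range over subsets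 of $V$. The numbers $0=\lambda_1\le\lambda_2\le\cdots\le\lambda_n\le 2$ are the eigenvalues of the problem $\Delta_2\vec x=\lambda D\vec x$, where $\Delta_2$ is the graph Laplacian matrix, $(\Delta_2\vec x)_i=\sum_{j:\{i,j\}\in E}(x_i-x_j)$. *)

theory Defs
  imports "HOL-Analysis.Analysis"
begin

(* A graph on n = CARD('n) vertices: the vertex set is the finite type 'n itself (V = UNIV), and
   the graph is given by its set E of edges, each an unordered pair of distinct vertices. *)
definition simple_graph :: "'n::finite set set \<Rightarrow> bool" where
  "simple_graph E \<longleftrightarrow> (\<forall>e\<in>E. card e = 2)"

definition deg :: "'n::finite set set \<Rightarrow> 'n \<Rightarrow> nat" where
  "deg E i = card {j. {i, j} \<in> E}"

definition vol :: "'n::finite set set \<Rightarrow> 'n set \<Rightarrow> nat" where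
  "vol E S = (\<Sum>i\<in>S. deg E i)"

definition edges_between :: "'n::finite set set \<Rightarrow> 'n set \<Rightarrow> 'n set \<Rightarrow> 'n set set" where
  "edges_between E V1 V2 = {e \<in> E. \<exists>i\<in>V1. \<exists>j\<in>V2. e = {i, j}}"

definition h_max :: "'n::finite set set \<Rightarrow> real" where
  "h_max E = Max {2 * real (card (edges_between E V1 (- V1))) / real (vol E UNIV) | V1. True}"

definition h_plus :: "'n::finite set set \<Rightarrow> real" where
  "h_plus E = Max {2 * real (card (edges_between E V1 V2)) / real (vol E (V1 \<union> V2)) | V1 V2.
     V1 \<inter> V2 = {} \<and> V1 \<union> V2 \<noteq> {}}"

definition h_plus_hat :: "'n::finite set set \<Rightarrow> real" where
  "h_plus_hat E = Max {
     (2 * real (card (edges_between E V1 V2))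
        + real (card (edges_between E (V1 \<union> V2) (- (V1 \<union> V2)))))
     / (real (vol E (V1 \<union> V2)) + real (card (edges_between E (V1 \<union> V2) (- (V1 \<union> V2))))) | V1 V2.
     V1 \<inter> V2 = {} \<and> V1 \<union> V2 \<noteq> {}}"

definition degree_matrix :: "'n::finite set set \<Rightarrow> real ^ 'n ^ 'n" where
  "degree_matrix E = (\<chi> i j. if i = j then real (deg E i) else 0)"

definition laplacian :: "'n::finite set set \<Rightarrow> real ^ 'n ^ 'n" where
  "laplacian E = (\<chi> i j. if i = j then real (deg E i) else if {i, j} \<in> E then - 1 else 0)"

lemma degree_matrix_mult: "(degree_matrix E *v x) $ i = real (deg E i) * x $ i"
  by (simp add: degree_matrix_def matrix_vector_mult_def if_distrib [of "\<lambda>a. a * _"] cong: if_cong)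

lemma laplacian_mult:
  assumes "simple_graph E"
  shows "(laplacian E *v x) $ i = (\<Sum>j | {i, j} \<in> E. x $ i - x $ j)"
proof -
  have ni: "{i} \<notin> E"
    using assms by (auto simp: simple_graph_def)
  have "(laplacian E *v x) $ i
      = (\<Sum>j\<in>UNIV. (if j = i then real (deg E i) * x $ j else 0) - (if {i, j} \<in> E then x $ j else 0))"
    unfolding laplacian_def matrix_vector_mult_def by (auto intro!: sum.cong simp: ni)
  also have "\<dots> = real (deg E i) * x $ i - (\<Sum>j | {i, j} \<in> E. x $ j)"
    by (simp add: sum_subtractf sum.If_cases)
  also have "\<dots> = (\<Sum>j | {i, j} \<in> E. x $ i - x $ j)"
    by (simp add: sum_subtractf deg_def)
  finally show ?thesis .
qed

definition graph_eigenvalue :: "'n::finite set set \<Rightarrow> real \<Rightarrow> bool" where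
  "graph_eigenvalue E \<mu> \<longleftrightarrow>
     (\<exists>x. x \<noteq> 0 \<and> laplacian E *v x = \<mu> *\<^sub>R (degree_matrix E *v x))"

(* Meaningful only without isolated vertices: otherwise the degree matrix is singular and the
   indicator vector of an isolated vertex makes every real number an eigenvalue. *)
definition lambda_max :: "'n::finite set set \<Rightarrow> real" where
  "lambda_max E = Max {\<mu>. graph_eigenvalue E \<mu>}"

end

theory Submission
  imports Defs
begin

text \<open>
  Write \<open>\<lambda>\<close>, \<open>h\<close>, \<open>h'\<close> for the largest eigenvalue, the dual Cheeger constant and its modified form.
  The left end of the chain is combinatorial. A maximum cut contains at least half of the edges,
  since moving a single vertex across it cannot enlarge it (\<open>exists_large_cut\<close>). A cut is a pair
  \<open>(V1, V2)\<close> that covers all vertices, so \<open>h\<close> is a maximum over more pairs than the maximum cut.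
  Passing from \<open>h\<close> to \<open>h'\<close> adds the same boundary term to the numerator and the denominator of a
  fraction that is at most 1, and so can only increase it.

  The eigenvalue enters through the Rayleigh quotient: \<open>x \<bullet> L x \<le> \<lambda> * (x \<bullet> D x)\<close> for all \<open>x\<close>
  (\<open>lambda_max_rayleigh\<close>). Its value at the vector that is 1 on \<open>V1\<close>, -1 on \<open>V2\<close> and 0 elsewhere
  gives, with \<open>a = 2 |E(V1, V2)|\<close>, \<open>b\<close> the number of edges leaving \<open>V1 \<union> V2\<close> and \<open>c\<close> the volume of
  \<open>V1 \<union> V2\<close>, the one spectral inequality that is needed: \<open>2 a + b \<le> \<lambda> c\<close>
  (\<open>signed_cut_le_lambda_max\<close>). Dropping \<open>b\<close> it yields \<open>2 h \<le> \<lambda>\<close>, hence \<open>\<lambda> \<ge> 1\<close>. Since \<open>a \<le> c\<close>, the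
  fraction \<open>(a + b) / (c + b)\<close> increases with \<open>b\<close>; inserting the largest possible \<open>b = \<lambda> c - 2 a\<close>
  gives
  \<open>(a + b) / (c + b) \<le> f (a / c)\<close> where \<open>f t = (\<lambda> - t) / (1 + \<lambda> - 2 t)\<close>.
  As \<open>\<lambda> \<ge> 1\<close>, the function \<open>f\<close> is increasing for \<open>t \<le> \<lambda> / 2\<close> (\<open>ratio_mono\<close>), so \<open>a / c \<le> h\<close> gives
  \<open>h' \<le> f h\<close>. Moreover \<open>\<lambda> / 2\<close> is a fixed point of \<open>f\<close>, so \<open>h' \<le> f h \<le> \<lambda> / 2\<close>, and monotonicity once
  more gives \<open>f h \<le> f h' \<le> \<lambda> / 2\<close>. Finally \<open>\<lambda> \<le> 2\<close> because \<open>(s - t)\<^sup>2 \<le> 2 * s\<^sup>2 + 2 * t\<^sup>2\<close> on each edge.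
\<close>

section \<open>Symmetric matrix pencils\<close>

lemma symmetric_matrix_inner:
  fixes A :: "real ^ 'n ^ 'n"
  assumes "transpose A = A"
  shows "(A *v x) \<bullet> y = x \<bullet> (A *v y)"
  using assms by (metis dot_lmul_matrix vector_transpose_matrix)

text \<open>
  A zero of a positive semidefinite form is a minimum, so the first-order term of the form there,
  which is \<open>2 * (C *v x)\<close>, has to vanish. Testing in the direction of \<open>C *v x\<close> makes this quantitative.
\<close>

lemma psd_form_zero_imp_kernel:
  fixes C :: "real ^ 'n ^ 'n"
  assumes sym: "transpose C = C" and psd: "\<And>y. 0 \<le> y \<bullet> (C *v y)"
    and zero: "x \<bullet> (C *v x) = 0"
  shows "C *v x = 0"
proof (rule ccontr)
  assume nz: "C *v x \<noteq> 0"
  define z where "z = C *v x"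
  define p where "p = z \<bullet> z"
  define q where "q = z \<bullet> (C *v z)"
  have p: "p > 0" using nz by (simp add: p_def z_def)
  have q: "q \<ge> 0" using psd by (simp add: q_def)
  have xz: "x \<bullet> (C *v z) = p"
    using symmetric_matrix_inner[OF sym, of x z] by (simp add: p_def z_def)
  \<comment> \<open>The form at \<open>x - s *\<^sub>R z\<close> is \<open>s * (s * q - 2 * p)\<close>, negative for this small \<open>s\<close>.\<close>
  define s where "s = p / (q + 1)"
  have s: "s > 0" using p q by (simp add: s_def)
  have "0 \<le> (x - s *\<^sub>R z) \<bullet> (C *v (x - s *\<^sub>R z))" by (rule psd)
  also have "\<dots> = s * (s * q - 2 * p)"
    using zero xz
    by (simp add: matrix_vector_mult_diff_distrib matrix_vector_mult_scaleR inner_diff_left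
        inner_diff_right algebra_simps flip: q_def z_def)
      (simp add: p_def)
  finally have "2 * p \<le> s * q" using s by (simp add: zero_le_mult_iff)
  moreover have "s * q \<le> p"
    using p q by (simp add: s_def field_simps)
  ultimately show False using p by simp
qed

definition pencil_eigenvalue :: "real ^ 'n ^ 'n \<Rightarrow> real ^ 'n ^ 'n \<Rightarrow> real \<Rightarrow> bool" where
  "pencil_eigenvalue A B \<mu> \<longleftrightarrow> (\<exists>x. x \<noteq> 0 \<and> A *v x = \<mu> *\<^sub>R (B *v x))"

text \<open>
  Eigenvectors for distinct eigenvalues are orthogonal with respect to \<open>B\<close>, hence linearly
  independent, and there are at most as many of them as the dimension. Finiteness is what makes
  the maximum of the set of eigenvalues meaningful.
\<close>

lemma finite_pencil_eigenvalues:
  fixes A B :: "real ^ 'n ^ 'n"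
  assumes symA: "transpose A = A" and symB: "transpose B = B"
    and pos: "\<And>y. y \<noteq> 0 \<Longrightarrow> 0 < y \<bullet> (B *v y)"
  shows "finite {\<mu>. pencil_eigenvalue A B \<mu>}"
proof -
  let ?S = "{\<mu>. pencil_eigenvalue A B \<mu>}"
  have "\<forall>\<mu>\<in>?S. \<exists>x. x \<noteq> 0 \<and> A *v x = \<mu> *\<^sub>R (B *v x)"
    by (simp add: pencil_eigenvalue_def)
  from bchoice[OF this] obtain v
    where v: "\<And>\<mu>. \<mu> \<in> ?S \<Longrightarrow> v \<mu> \<noteq> 0 \<and> A *v v \<mu> = \<mu> *\<^sub>R (B *v v \<mu>)"
    by blast
  have orth: "(B *v v \<mu>) \<bullet> v \<nu> = 0" if "\<mu> \<in> ?S" "\<nu> \<in> ?S" "\<mu> \<noteq> \<nu>" for \<mu> \<nu>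
  proof -
    have "\<mu> * ((B *v v \<mu>) \<bullet> v \<nu>) = (A *v v \<mu>) \<bullet> v \<nu>" using v that by simp
    also have "\<dots> = v \<mu> \<bullet> (A *v v \<nu>)" by (rule symmetric_matrix_inner[OF symA])
    also have "\<dots> = \<nu> * (v \<mu> \<bullet> (B *v v \<nu>))" using v that by simp
    also have "\<dots> = \<nu> * ((B *v v \<mu>) \<bullet> v \<nu>)" by (simp add: symmetric_matrix_inner[OF symB])
    finally show ?thesis using that by simp
  qed
  have self: "(B *v v \<mu>) \<bullet> v \<mu> > 0" if "\<mu> \<in> ?S" for \<mu>
    using pos v that by (simp add: inner_commute)
  have inj: "inj_on v ?S"
    using orth self by (metis inj_onI less_irrefl)
  have "independent (v ` ?S)"
    unfolding dependent_def
  proof safe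
    fix \<mu> assume mu: "pencil_eigenvalue A B \<mu>" and sp: "v \<mu> \<in> span (v ` ?S - {v \<mu>})"
    \<comment> \<open>The \<open>B\<close>-orthogonal complement of \<open>v \<mu>\<close> contains the other eigenvectors but not \<open>v \<mu>\<close>.\<close>
    have "span (v ` ?S - {v \<mu>}) \<subseteq> {y. (B *v v \<mu>) \<bullet> y = 0}"
      by (rule span_minimal) (use orth mu in \<open>auto intro!: subspace_hyperplane\<close>)
    with sp self[of \<mu>] mu show False by auto
  qed
  then have "finite (v ` ?S)" by (rule independent_imp_finite)
  then show ?thesis using inj by (rule finite_imageD)
qed

text \<open>
  The Rayleigh quotient attains its maximum \<open>\<mu>\<close> on the compact unit sphere. Then \<open>\<mu> *\<^sub>R B - A\<close> is
  positive semidefinite and its form vanishes at the maximizer, which is therefore an eigenvector.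
\<close>

lemma pencil_rayleigh:
  fixes A B :: "real ^ 'n ^ 'n"
  assumes symA: "transpose A = A" and symB: "transpose B = B"
    and pos: "\<And>y. y \<noteq> 0 \<Longrightarrow> 0 < y \<bullet> (B *v y)"
  obtains \<mu> where "pencil_eigenvalue A B \<mu>" "\<And>y. y \<bullet> (A *v y) \<le> \<mu> * (y \<bullet> (B *v y))"
proof -
  define R where "R y = (y \<bullet> (A *v y)) / (y \<bullet> (B *v y))" for y
  have nz: "y \<bullet> (B *v y) \<noteq> 0" if "y \<in> sphere 0 1" for y
    using pos[of y] that by (cases "y = 0") auto
  have cont: "continuous_on (sphere 0 1) R"
    unfolding R_def
    by (intro continuous_intros linear_continuous_on matrix_vector_mul_bounded_linear ballI nz)
  obtain x0 :: "real ^ 'n" where "norm x0 = 1" using vector_choose_size[of 1] by auto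
  then have "sphere (0 :: real ^ 'n) 1 \<noteq> {}" by auto
  then obtain x where x: "x \<in> sphere 0 1" and mx: "\<And>y. y \<in> sphere 0 1 \<Longrightarrow> R y \<le> R x"
    using continuous_attains_sup[OF compact_sphere _ cont] by blast
  have x0: "x \<noteq> 0" using x by auto
  have le: "y \<bullet> (A *v y) \<le> R x * (y \<bullet> (B *v y))" for y
  proof (cases "y = 0")
    case False
    have "R (inverse (norm y) *\<^sub>R y) = R y"
      using False by (simp add: R_def matrix_vector_mult_scaleR)
    moreover have "R (inverse (norm y) *\<^sub>R y) \<le> R x"
      using False by (intro mx) simp
    ultimately have "R y \<le> R x" by simp
    then show ?thesis using pos[OF False] by (simp add: R_def[of y] divide_le_eq)
  qed simp
  let ?C = "R x *\<^sub>R B - A"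
  have C: "?C *v y = R x *\<^sub>R (B *v y) - A *v y" for y
    by (simp add: matrix_vector_mult_diff_rdistrib scaleR_matrix_vector_assoc)
  have "?C *v x = 0"
  proof (rule psd_form_zero_imp_kernel)
    show "transpose ?C = ?C"
      using symA symB by (simp add: transpose_def vec_eq_iff)
    show "0 \<le> y \<bullet> (?C *v y)" for y
      using le[of y] by (simp add: C inner_diff_right)
    show "x \<bullet> (?C *v x) = 0"
      unfolding C using pos[OF x0] by (simp add: inner_diff_right R_def)
  qed
  then have "pencil_eigenvalue A B (R x)"
    using x0 by (auto simp: pencil_eigenvalue_def C)
  with le that show thesis by blast
qed

section \<open>Edge counts as sums over ordered pairs\<close>

definition adj :: "'n::finite set set \<Rightarrow> 'n \<Rightarrow> 'n \<Rightarrow> real" where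
  "adj E i j = of_bool ({i, j} \<in> E)"

text \<open>
  Counting ordered pairs makes the count additive in both sets and expresses volumes, cuts and
  quadratic forms as sums of the same kind over all pairs of vertices.
\<close>

definition arcs :: "'n::finite set set \<Rightarrow> 'n set \<Rightarrow> 'n set \<Rightarrow> real" where
  "arcs E S T = (\<Sum>i\<in>S. \<Sum>j\<in>T. adj E i j)"

lemma adj_commute: "adj E i j = adj E j i"
  by (simp add: adj_def insert_commute)

lemma adj_nonneg: "0 \<le> adj E i j"
  by (simp add: adj_def)

lemma adj_self: "simple_graph E \<Longrightarrow> adj E i i = 0"
  by (auto simp: adj_def simple_graph_def)

lemma arcs_commute: "arcs E S T = arcs E T S"
  unfolding arcs_def by (subst sum.swap) (simp add: adj_commute)

text \<open>
  In this form, identities between edge counts reduce to identities for each single pair of vertices.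
\<close>

lemma arcs_indicator: "arcs E S T = (\<Sum>i\<in>UNIV. \<Sum>j\<in>UNIV. adj E i j * of_bool (i \<in> S \<and> j \<in> T))"
  unfolding arcs_def sum.cartesian_product by (intro sum.mono_neutral_cong_left) auto

lemma deg_adj: "real (deg E i) = (\<Sum>j\<in>UNIV. adj E i j)"
  by (simp add: deg_def adj_def of_bool_def sum.If_cases)

lemma vol_arcs: "real (vol E S) = arcs E S UNIV"
  by (simp add: vol_def arcs_def deg_adj)

text \<open>
  Disjointness makes the orientation from \<open>S\<close> to \<open>T\<close> of each edge unique, so no edge is counted twice.
\<close>

lemma card_edges_between:
  assumes "S \<inter> T = {}"
  shows "real (card (edges_between E S T)) = arcs E S T"
proof -
  let ?P = "{(i, j) \<in> S \<times> T. {i, j} \<in> E}"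
  have "edges_between E S T = (\<lambda>(i, j). {i, j}) ` ?P"
    by (auto simp: edges_between_def)
  moreover have "inj_on (\<lambda>(i, j). {i, j}) ?P"
    using assms by (auto simp: inj_on_def doubleton_eq_iff)
  ultimately have "card (edges_between E S T) = card ?P"
    by (simp add: card_image)
  moreover have "arcs E S T = (\<Sum>p\<in>S \<times> T. of_bool (p \<in> ?P))"
    unfolding arcs_def sum.cartesian_product by (intro sum.cong) (auto simp: adj_def)
  moreover have "\<dots> = (\<Sum>p\<in>?P. 1)"
    by (intro sum.mono_neutral_cong_right) auto
  ultimately show ?thesis by simp
qed

section \<open>The Laplacian quadratic form\<close>

lemma laplacian_form:
  assumes "simple_graph E"
  shows "x \<bullet> (laplacian E *v x) = (\<Sum>i\<in>UNIV. \<Sum>j\<in>UNIV. adj E i j * (x $ i - x $ j)\<^sup>2) / 2"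
proof -
  have "x \<bullet> (laplacian E *v x) = (\<Sum>i\<in>UNIV. \<Sum>j\<in>UNIV. adj E i j * (x $ i * (x $ i - x $ j)))"
    unfolding inner_vec_def laplacian_mult[OF assms] inner_real_def sum_distrib_left
    by (intro sum.cong refl sum.mono_neutral_cong_left) (auto simp: adj_def)
  moreover have "\<dots> = (\<Sum>i\<in>UNIV. \<Sum>j\<in>UNIV. adj E i j * (x $ j * (x $ j - x $ i)))"
    by (subst sum.swap) (simp add: adj_commute)
  ultimately have "2 * (x \<bullet> (laplacian E *v x))
      = (\<Sum>i\<in>UNIV. \<Sum>j\<in>UNIV. adj E i j * (x $ i * (x $ i - x $ j)))
      + (\<Sum>i\<in>UNIV. \<Sum>j\<in>UNIV. adj E i j * (x $ j * (x $ j - x $ i)))"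
    by simp
  also have "\<dots> = (\<Sum>i\<in>UNIV. \<Sum>j\<in>UNIV. adj E i j * (x $ i - x $ j)\<^sup>2)"
    unfolding sum.distrib[symmetric]
    by (intro sum.cong refl) (simp add: power2_eq_square algebra_simps)
  finally show ?thesis by simp
qed

lemma degree_form: "x \<bullet> (degree_matrix E *v x) = (\<Sum>i\<in>UNIV. \<Sum>j\<in>UNIV. adj E i j * (x $ i)\<^sup>2)"
  by (simp add: inner_vec_def degree_matrix_mult deg_adj sum_distrib_left sum_distrib_right
      power2_eq_square mult_ac)

lemma laplacian_form_le:
  assumes "simple_graph E"
  shows "x \<bullet> (laplacian E *v x) \<le> 2 * (x \<bullet> (degree_matrix E *v x))"
proof -
  have swap: "x \<bullet> (degree_matrix E *v x) = (\<Sum>i\<in>UNIV. \<Sum>j\<in>UNIV. adj E i j * (x $ j)\<^sup>2)"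
    unfolding degree_form by (subst sum.swap) (simp add: adj_commute)
  have "(\<Sum>i\<in>UNIV. \<Sum>j\<in>UNIV. adj E i j * (x $ i - x $ j)\<^sup>2)
      \<le> (\<Sum>i\<in>UNIV. \<Sum>j\<in>UNIV. 2 * (adj E i j * (x $ i)\<^sup>2) + 2 * (adj E i j * (x $ j)\<^sup>2))"
  proof (intro sum_mono)
    fix i j
    have "(x $ i - x $ j)\<^sup>2 \<le> 2 * (x $ i)\<^sup>2 + 2 * (x $ j)\<^sup>2"
      using zero_le_power2[of "x $ i + x $ j"] by (simp add: power2_eq_square algebra_simps)
    from mult_left_mono[OF this adj_nonneg[of E i j]]
    show "adj E i j * (x $ i - x $ j)\<^sup>2 \<le> 2 * (adj E i j * (x $ i)\<^sup>2) + 2 * (adj E i j * (x $ j)\<^sup>2)"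
      by (simp add: algebra_simps)
  qed
  also have "\<dots> = 4 * (x \<bullet> (degree_matrix E *v x))"
    unfolding sum.distrib sum_distrib_left[symmetric] swap[symmetric] degree_form[symmetric] by simp
  finally show ?thesis by (simp add: laplacian_form[OF assms])
qed

lemma degree_form_pos:
  assumes "\<forall>i. 0 < deg E i" "x \<noteq> 0"
  shows "0 < x \<bullet> (degree_matrix E *v x)"
proof -
  obtain k where "x $ k \<noteq> 0" using assms(2) by (auto simp: vec_eq_iff)
  moreover have "x \<bullet> (degree_matrix E *v x) = (\<Sum>i\<in>UNIV. real (deg E i) * (x $ i)\<^sup>2)"
    by (simp add: inner_vec_def degree_matrix_mult power2_eq_square mult_ac)
  ultimately show ?thesis
    using assms(1) by (auto intro: sum_pos2[of _ k])
qed

text \<open>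
  Positive degrees make the degree matrix positive definite, so the results on pencils apply to
  the Laplacian and the degree matrix.
\<close>

lemma lambda_max_rayleigh:
  assumes sg: "simple_graph E" and deg: "\<forall>i. 0 < deg E i"
  shows "x \<bullet> (laplacian E *v x) \<le> lambda_max E * (x \<bullet> (degree_matrix E *v x))"
    and "lambda_max E \<le> 2"
proof -
  have eq: "graph_eigenvalue E = pencil_eigenvalue (laplacian E) (degree_matrix E)"
    by (simp add: fun_eq_iff graph_eigenvalue_def pencil_eigenvalue_def)
  have symL: "transpose (laplacian E) = laplacian E"
    by (auto simp: transpose_def laplacian_def vec_eq_iff insert_commute)
  have symD: "transpose (degree_matrix E) = degree_matrix E"
    by (auto simp: transpose_def degree_matrix_def vec_eq_iff)
  note pos = degree_form_pos[OF deg]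
  have fin: "finite {\<mu>. graph_eigenvalue E \<mu>}"
    unfolding eq by (rule finite_pencil_eigenvalues[OF symL symD pos])
  obtain \<mu> where mu: "graph_eigenvalue E \<mu>"
    "\<And>y. y \<bullet> (laplacian E *v y) \<le> \<mu> * (y \<bullet> (degree_matrix E *v y))"
    unfolding eq using pencil_rayleigh[OF symL symD pos] by blast
  have "\<mu> \<le> lambda_max E"
    unfolding lambda_max_def using fin mu by simp
  moreover have "0 \<le> x \<bullet> (degree_matrix E *v x)"
    using pos[of x] by (cases "x = 0") auto
  ultimately show "x \<bullet> (laplacian E *v x) \<le> lambda_max E * (x \<bullet> (degree_matrix E *v x))"
    using mu(2)[of x] by (meson mult_right_mono order_trans)
  have "graph_eigenvalue E (lambda_max E)"
    unfolding lambda_max_def using Max_in[OF fin] mu(1) by blast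
  then obtain y where y: "y \<noteq> 0" "laplacian E *v y = lambda_max E *\<^sub>R (degree_matrix E *v y)"
    by (auto simp: graph_eigenvalue_def)
  have "lambda_max E * (y \<bullet> (degree_matrix E *v y)) \<le> 2 * (y \<bullet> (degree_matrix E *v y))"
    using laplacian_form_le[OF sg, of y] y by simp
  then show "lambda_max E \<le> 2" using pos[OF y(1)] by simp
qed

section \<open>Cheeger-type constants\<close>

text \<open>
  Both orientations of an edge between \<open>V1\<close> and \<open>V2\<close> contribute to the volume of the union.
\<close>

lemma arcs_pair_le_vol:
  assumes "V1 \<inter> V2 = {}"
  shows "2 * arcs E V1 V2 \<le> arcs E (V1 \<union> V2) UNIV"
proof -
  have "arcs E V1 V2 + arcs E V2 V1 \<le> arcs E (V1 \<union> V2) UNIV"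
    unfolding arcs_indicator sum.distrib[symmetric]
    using assms by (intro sum_mono) (auto simp: adj_nonneg)
  then show ?thesis by (simp add: arcs_commute[of E V2 V1])
qed

text \<open>
  For the vector \<open>x\<close> equal to 1 on \<open>V1\<close>, -1 on \<open>V2\<close> and 0 elsewhere, \<open>(x\<^sub>i - x\<^sub>j)\<^sup>2\<close> is 4 on an edge
  between \<open>V1\<close> and \<open>V2\<close>, 1 on an edge leaving the union and 0 on all others.
\<close>

lemma signed_cut_le_lambda_max:
  fixes E :: "'n::finite set set"
  assumes sg: "simple_graph E" and deg: "\<forall>i. 0 < deg E i" and disj: "V1 \<inter> V2 = {}"
  shows "4 * arcs E V1 V2 + arcs E (V1 \<union> V2) (- (V1 \<union> V2)) \<le> lambda_max E * arcs E (V1 \<union> V2) UNIV"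
proof -
  let ?U = "V1 \<union> V2"
  define x :: "real ^ 'n" where "x = (\<chi> i. of_bool (i \<in> V1) - of_bool (i \<in> V2))"
  have "(\<Sum>i\<in>UNIV. \<Sum>j\<in>UNIV. adj E i j * (x $ i - x $ j)\<^sup>2)
      = 4 * arcs E V1 V2 + 4 * arcs E V2 V1 + arcs E ?U (- ?U) + arcs E (- ?U) ?U"
    unfolding arcs_indicator sum_distrib_left sum.distrib[symmetric]
    using disj by (intro sum.cong refl) (auto simp: x_def)
  also have "\<dots> = 2 * (4 * arcs E V1 V2 + arcs E ?U (- ?U))"
    unfolding arcs_commute[of E V2 V1] arcs_commute[of E "- ?U" ?U] by simp
  finally have L: "x \<bullet> (laplacian E *v x) = 4 * arcs E V1 V2 + arcs E ?U (- ?U)"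
    by (simp add: laplacian_form[OF sg])
  have D: "x \<bullet> (degree_matrix E *v x) = arcs E ?U UNIV"
    unfolding degree_form arcs_indicator
    using disj by (intro sum.cong refl) (auto simp: x_def)
  show ?thesis using lambda_max_rayleigh(1)[OF sg deg, of x] by (simp add: L D)
qed

text \<open>
  In a maximum cut every vertex has at least as many neighbours on the other side as on its own,
  for otherwise moving it across would enlarge the cut. The claim is the sum of this over all vertices.
\<close>

lemma exists_large_cut:
  fixes E :: "'n::finite set set"
  assumes sg: "simple_graph E"
  obtains S where "arcs E UNIV UNIV \<le> 4 * arcs E S (- S)"
proof -
  define c where "c S = arcs E S (- S)" for S
  have "Max (range c) \<in> range c" by (rule Max_in) auto
  then obtain S where S: "c S = Max (range c)" by (metis imageE)
  then have mx: "c T \<le> c S" for T by simp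
  \<comment> \<open>A general maximizer \<open>T\<close>, because the complement of \<open>S\<close> is needed as well.\<close>
  have flip: "(\<Sum>j\<in>- T. adj E i j) \<le> (\<Sum>j\<in>T. adj E i j)"
    if T: "c T = c S" and i: "i \<notin> T" for T i
  proof -
    have split: "(\<Sum>j\<in>- T. f j) = f i + (\<Sum>j\<in>- insert i T. f j)" for f :: "'n \<Rightarrow> real"
    proof -
      have "- T = insert i (- insert i T)" using i by auto
      then show ?thesis by (metis ComplD finite insertI1 sum.insert)
    qed
    have "c (insert i T) = (\<Sum>j\<in>- insert i T. adj E i j) + (\<Sum>k\<in>T. \<Sum>j\<in>- insert i T. adj E k j)"
      unfolding c_def arcs_def using i by simp
    moreover have "c T = (\<Sum>k\<in>T. adj E k i) + (\<Sum>k\<in>T. \<Sum>j\<in>- insert i T. adj E k j)"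
      unfolding c_def arcs_def by (simp add: split sum.distrib)
    moreover have "c (insert i T) \<le> c T" using mx T by simp
    moreover have "(\<Sum>j\<in>- T. adj E i j) = (\<Sum>j\<in>- insert i T. adj E i j)"
      by (simp add: split adj_self[OF sg])
    ultimately show ?thesis by (simp add: adj_commute[of E i])
  qed
  have half: "arcs E (- T) (- T) \<le> arcs E (- T) T" if "c T = c S" for T
    unfolding arcs_def using flip[OF that] by (intro sum_mono) simp
  have "c (- S) = c S" by (simp add: c_def arcs_commute)
  from half[OF this] half[of S]
  have "arcs E S S \<le> arcs E S (- S)" "arcs E (- S) (- S) \<le> arcs E S (- S)"
    by (simp_all add: arcs_commute[of E "- S" S])
  moreover have "arcs E UNIV UNIV = arcs E S S + arcs E S (- S) + arcs E (- S) S + arcs E (- S) (- S)"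
    unfolding arcs_indicator sum.distrib[symmetric] by (intro sum.cong refl) auto
  ultimately have "arcs E UNIV UNIV \<le> 4 * arcs E S (- S)"
    by (simp add: arcs_commute[of E "- S" S])
  with that show thesis .
qed

lemma arcs_vol_pos:
  assumes "\<forall>i. 0 < deg E i" "U \<noteq> {}"
  shows "0 < arcs E U UNIV"
  using assms unfolding arcs_def deg_adj[symmetric] by (intro sum_pos) auto

lemma arcs_nonneg: "0 \<le> arcs E S T"
  by (simp add: arcs_def adj_nonneg sum_nonneg)

lemma h_max_arcs: "h_max E = Max (range (\<lambda>S. 2 * arcs E S (- S) / arcs E UNIV UNIV))"
  by (simp add: h_max_def card_edges_between vol_arcs full_SetCompr_eq)

definition disjoint_pairs :: "('n set \<times> 'n set) set" where
  "disjoint_pairs = {(V1, V2). V1 \<inter> V2 = {} \<and> V1 \<union> V2 \<noteq> {}}"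

lemma disjoint_pairs_nonempty: "disjoint_pairs \<noteq> {}"
  by (auto simp: disjoint_pairs_def intro: exI[of _ UNIV])

lemma setcompr_pair_image: "{f a b | a b. P a b} = (\<lambda>(a, b). f a b) ` {(a, b). P a b}"
  by auto

lemma h_plus_arcs:
  "h_plus E = Max ((\<lambda>(V1, V2). 2 * arcs E V1 V2 / arcs E (V1 \<union> V2) UNIV) ` disjoint_pairs)"
  unfolding h_plus_def disjoint_pairs_def setcompr_pair_image
  by (intro arg_cong[where f = Max] image_cong)
    (auto simp: card_edges_between vol_arcs)

lemma h_plus_hat_arcs:
  "h_plus_hat E = Max ((\<lambda>(V1, V2).
     (2 * arcs E V1 V2 + arcs E (V1 \<union> V2) (- (V1 \<union> V2)))
     / (arcs E (V1 \<union> V2) UNIV + arcs E (V1 \<union> V2) (- (V1 \<union> V2)))) ` disjoint_pairs)"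
  unfolding h_plus_hat_def card_edges_between[OF Compl_disjoint] disjoint_pairs_def setcompr_pair_image
  by (intro arg_cong[where f = Max] image_cong)
    (auto simp: card_edges_between vol_arcs)

lemma half_le_h_max:
  assumes "simple_graph E" "\<forall>i. 0 < deg E i"
  shows "1 / 2 \<le> h_max E"
proof -
  obtain S where S: "arcs E UNIV UNIV \<le> 4 * arcs E S (- S)"
    using exists_large_cut[OF assms(1)] .
  have "1 / 2 \<le> 2 * arcs E S (- S) / arcs E UNIV UNIV"
    using S arcs_vol_pos[OF assms(2), of UNIV] by (simp add: field_simps)
  also have "\<dots> \<le> h_max E" unfolding h_max_arcs by (intro Max_ge) auto
  finally show ?thesis .
qed

lemma h_max_le_h_plus: "h_max E \<le> h_plus E"
  unfolding h_max_arcs h_plus_arcs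
proof (intro Max_mono image_subsetI)
  fix S
  show "2 * arcs E S (- S) / arcs E UNIV UNIV
      \<in> (\<lambda>(V1, V2). 2 * arcs E V1 V2 / arcs E (V1 \<union> V2) UNIV) ` disjoint_pairs"
    by (rule rev_image_eqI[of "(S, - S)"]) (simp_all add: disjoint_pairs_def)
qed simp_all

lemma h_plus_ge:
  assumes "\<forall>i. 0 < deg E i" "V1 \<inter> V2 = {}" "V1 \<union> V2 \<noteq> {}"
  shows "2 * arcs E V1 V2 \<le> h_plus E * arcs E (V1 \<union> V2) UNIV"
proof -
  have "2 * arcs E V1 V2 / arcs E (V1 \<union> V2) UNIV \<le> h_plus E"
    unfolding h_plus_arcs using assms
    by (intro Max_ge rev_image_eqI[of "(V1, V2)"]) (simp_all add: disjoint_pairs_def)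
  then show ?thesis using arcs_vol_pos[OF assms(1,3)] by (simp add: field_simps)
qed

lemma mediant_one_mono:
  fixes a b b' c :: real
  assumes "a \<le> c" "0 < c" "0 \<le> b" "b \<le> b'"
  shows "(a + b) / (c + b) \<le> (a + b') / (c + b')"
proof -
  have "0 \<le> (c - a) * (b' - b)" using assms by simp
  then show ?thesis using assms by (simp add: frac_le_eq divide_le_0_iff field_simps)
qed

lemma h_plus_le_h_plus_hat:
  assumes "\<forall>i. 0 < deg E i"
  shows "h_plus E \<le> h_plus_hat E"
  unfolding h_plus_arcs
proof (intro Max.boundedI)
  fix r assume "r \<in> (\<lambda>(V1, V2). 2 * arcs E V1 V2 / arcs E (V1 \<union> V2) UNIV) ` disjoint_pairs"
  then obtain V1 V2 where V: "(V1, V2) \<in> disjoint_pairs" "V1 \<inter> V2 = {}" "V1 \<union> V2 \<noteq> {}"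
    and r: "r = 2 * arcs E V1 V2 / arcs E (V1 \<union> V2) UNIV"
    by (auto simp: disjoint_pairs_def)
  let ?b = "arcs E (V1 \<union> V2) (- (V1 \<union> V2))"
  have "r \<le> (2 * arcs E V1 V2 + ?b) / (arcs E (V1 \<union> V2) UNIV + ?b)"
    using mediant_one_mono[OF arcs_pair_le_vol[OF V(2)] arcs_vol_pos[OF assms V(3)] order_refl arcs_nonneg]
    by (simp add: r)
  also have "\<dots> \<le> h_plus_hat E"
    unfolding h_plus_hat_arcs using V(1)
    by (intro Max_ge rev_image_eqI[of "(V1, V2)"]) simp_all
  finally show "r \<le> h_plus_hat E" .
qed (simp_all add: disjoint_pairs_nonempty)

text \<open>
  This is the bound for signed cuts, at a pair that attains \<open>h_plus\<close>, without the boundary term. It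
  keeps the denominator \<open>1 + lambda_max E - 2 * h_plus E\<close> at least 1.
\<close>

lemma two_h_plus_le_lambda_max:
  assumes "simple_graph E" "\<forall>i. 0 < deg E i"
  shows "2 * h_plus E \<le> lambda_max E"
proof -
  have "h_plus E \<in> (\<lambda>(V1, V2). 2 * arcs E V1 V2 / arcs E (V1 \<union> V2) UNIV) ` disjoint_pairs"
    unfolding h_plus_arcs by (rule Max_in) (simp_all add: disjoint_pairs_nonempty)
  then obtain V1 V2 where V: "V1 \<inter> V2 = {}" "V1 \<union> V2 \<noteq> {}"
    and h: "h_plus E = 2 * arcs E V1 V2 / arcs E (V1 \<union> V2) UNIV"
    by (auto simp: disjoint_pairs_def)
  have "4 * arcs E V1 V2 \<le> lambda_max E * arcs E (V1 \<union> V2) UNIV"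
    using signed_cut_le_lambda_max[OF assms V(1)] arcs_nonneg[of E "V1 \<union> V2" "- (V1 \<union> V2)"] by linarith
  then show ?thesis using arcs_vol_pos[OF assms(2) V(2)] by (simp add: h field_simps)
qed

text \<open>
  The derivative of \<open>(l - t) / (1 + l - 2 * t)\<close> in \<open>t\<close> is \<open>(l - 1) / (1 + l - 2 * t)\<^sup>2\<close>.
\<close>

lemma ratio_mono:
  fixes l s t :: real
  assumes "1 \<le> l" "s \<le> t" "2 * t \<le> l"
  shows "(l - s) / (1 + l - 2 * s) \<le> (l - t) / (1 + l - 2 * t)"
proof -
  have "0 \<le> (l - 1) * (t - s)" using assms by simp
  then have "(l - s) * (1 + l - 2 * t) \<le> (l - t) * (1 + l - 2 * s)" by (simp add: algebra_simps)
  moreover have "0 < 1 + l - 2 * s" "0 < 1 + l - 2 * t" using assms by linarith+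
  ultimately show ?thesis by (simp add: divide_le_eq pos_le_divide_eq)
qed

text \<open>
  The ratio is increasing in \<open>t\<close> and takes the value \<open>l / 2\<close> at \<open>t = l / 2\<close>.
\<close>

lemma ratio_le_half:
  fixes l t :: real
  assumes "1 \<le> l" "2 * t \<le> l"
  shows "(l - t) / (1 + l - 2 * t) \<le> l / 2"
  using ratio_mono[OF assms(1), of t "l / 2"] assms by simp

text \<open>
  For a given pair, the spectral inequality bounds the number \<open>b\<close> of boundary edges by \<open>l * c - 2 * a\<close>. With this
  bound in place of \<open>b\<close>, the quotient depends on the pair only through \<open>a / c\<close>, and is increasing in it.
\<close>

lemma h_plus_hat_le:
  assumes sg: "simple_graph E" and deg: "\<forall>i. 0 < deg E i"
  shows "h_plus_hat E \<le> (lambda_max E - h_plus E) / (1 + lambda_max E - 2 * h_plus E)"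
  unfolding h_plus_hat_arcs
proof (intro Max.boundedI)
  let ?l = "lambda_max E"
  have h: "2 * h_plus E \<le> ?l" by (rule two_h_plus_le_lambda_max[OF assms])
  have l: "1 \<le> ?l" using h half_le_h_max[OF assms] h_max_le_h_plus[of E] by linarith
  fix r assume "r \<in> (\<lambda>(V1, V2). (2 * arcs E V1 V2 + arcs E (V1 \<union> V2) (- (V1 \<union> V2)))
     / (arcs E (V1 \<union> V2) UNIV + arcs E (V1 \<union> V2) (- (V1 \<union> V2)))) ` disjoint_pairs"
  then obtain V1 V2 where V: "V1 \<inter> V2 = {}" "V1 \<union> V2 \<noteq> {}"
    and r: "r = (2 * arcs E V1 V2 + arcs E (V1 \<union> V2) (- (V1 \<union> V2)))
     / (arcs E (V1 \<union> V2) UNIV + arcs E (V1 \<union> V2) (- (V1 \<union> V2)))"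
    by (auto simp: disjoint_pairs_def)
  define a where "a = 2 * arcs E V1 V2"
  define b where "b = arcs E (V1 \<union> V2) (- (V1 \<union> V2))"
  define c where "c = arcs E (V1 \<union> V2) UNIV"
  have c: "0 < c" unfolding c_def by (rule arcs_vol_pos[OF deg V(2)])
  have ac: "a \<le> c" unfolding a_def c_def by (rule arcs_pair_le_vol[OF V(1)])
  have ah: "a / c \<le> h_plus E"
    using h_plus_ge[OF deg V] c by (simp add: a_def c_def divide_le_eq)
  have b: "b \<le> ?l * c - 2 * a"
    using signed_cut_le_lambda_max[OF assms V(1)] by (simp add: a_def b_def c_def)
  have "r = (a + b) / (c + b)" by (simp add: r a_def b_def c_def)
  also have "\<dots> \<le> (a + (?l * c - 2 * a)) / (c + (?l * c - 2 * a))"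
    using ac c b arcs_nonneg by (intro mediant_one_mono) (auto simp: b_def)
  also have "\<dots> = (c * (?l - a / c)) / (c * (1 + ?l - 2 * (a / c)))"
    using c by (simp add: algebra_simps)
  also have "\<dots> = (?l - a / c) / (1 + ?l - 2 * (a / c))"
    using c by simp
  also have "\<dots> \<le> (?l - h_plus E) / (1 + ?l - 2 * h_plus E)"
    by (rule ratio_mono[OF l ah h])
  finally show "r \<le> (?l - h_plus E) / (1 + ?l - 2 * h_plus E)" .
qed (simp_all add: disjoint_pairs_nonempty)

theorem theorem1p1:
  fixes E :: "'n::finite set set"
  assumes "simple_graph E"
    and "\<forall>i. 0 < deg E i"
  shows "1 / 2 \<le> h_max E
    \<and> h_max E \<le> h_plus E
    \<and> h_plus E \<le> h_plus_hat E
    \<and> h_plus_hat E \<le> (lambda_max E - h_plus E) / (1 + lambda_max E - 2 * h_plus E)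
    \<and> (lambda_max E - h_plus E) / (1 + lambda_max E - 2 * h_plus E)
        \<le> (lambda_max E - h_plus_hat E) / (1 + lambda_max E - 2 * h_plus_hat E)
    \<and> (lambda_max E - h_plus_hat E) / (1 + lambda_max E - 2 * h_plus_hat E) \<le> lambda_max E / 2
    \<and> lambda_max E / 2 \<le> 1"
proof -
  note half = half_le_h_max[OF assms] and mp = h_max_le_h_plus[of E]
    and pp = h_plus_le_h_plus_hat[OF assms(2)] and hat = h_plus_hat_le[OF assms]
    and h = two_h_plus_le_lambda_max[OF assms]
  have l: "1 \<le> lambda_max E" using half mp h by linarith
  have hat': "2 * h_plus_hat E \<le> lambda_max E"
    using hat ratio_le_half[OF l h] by linarith
  show ?thesis
    using half mp pp hat ratio_mono[OF l pp hat'] ratio_le_half[OF l hat']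
      lambda_max_rayleigh(2)[OF assms] by simp
qed

end
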